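(* Let $\theta$ be the extremal coefficient function and $\chi:T\times T\to[0,1]$ the extremal correlation function of a max-stable random field on a metric space $T$ with standard Fréchet marginals. Then $\theta$ is continuous if and only if $\chi$ is continuous.
   Context: A random field $X=\{X_t\}_{t\in T}$ has standard Fréchet marginals if $\mathbb P(X_t\le x)=e^{-1/x}$ for all $t\in T$, $x\ge 0$ (value $0$ at $x=0$). Such a field is max-stable if for every $n\ge1$ and independent copies $X^{(1)},\dots,X^{(n)}$ of $X$ the field $n^{-1}\max_{i}X^{(i)}$ has the same (finite-dimensional) distributions as $X$. $\mathcal F(T)$ denotes the set of finite subsets of $T$. The extremal coefficient function is $\theta:\mathcal F(T)\to[0,\infty)$, $\theta(\emptyset):=0$, $\theta(M):=-x\log\mathbb P(\max_{t\in M}X_t\le x)$ for non-empty finite $M$ and any $x\in(0,\infty)$ (independent of $x$). The extremal correlation function is $\chi(s,t):=\lim_{x\uparrow\infty}\mathbb P(X_s\ge x\mid X_t\ge x)=2-\theta(\{s,t\})$. A function $f:\mathcal F(T)\to\mathbb R$ is continuous if for all $m\ge0$ the induced function $f^{(m)}:T^m\to\mathbb R$, $f^{(m)}(t_1,\dots,t_m)=f(\{t_1,\dots,t_m\})$, is continuous. *)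

theory Defs
  imports "HOL-Probability.Probability"
begin

definition random_field :: "'w measure \<Rightarrow> ('t \<Rightarrow> 'w \<Rightarrow> real) \<Rightarrow> bool" where
  "random_field M X \<longleftrightarrow> prob_space M \<and> (\<forall>t. X t \<in> borel_measurable M)"

definition same_fdd ::
    "'w measure \<Rightarrow> ('t \<Rightarrow> 'w \<Rightarrow> real) \<Rightarrow> 'v measure \<Rightarrow> ('t \<Rightarrow> 'v \<Rightarrow> real) \<Rightarrow> bool" where
  "same_fdd M X N Y \<longleftrightarrow>
     (\<forall>F. finite F \<longrightarrow>
        distr M (PiM F (\<lambda>_. borel)) (\<lambda>\<omega>. \<lambda>t\<in>F. X t \<omega>) =
        distr N (PiM F (\<lambda>_. borel)) (\<lambda>\<omega>. \<lambda>t\<in>F. Y t \<omega>))"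

definition independent_copies ::
    "'w measure \<Rightarrow> ('t \<Rightarrow> 'w \<Rightarrow> real) \<Rightarrow> nat \<Rightarrow> 'v measure \<Rightarrow> (nat \<Rightarrow> 't \<Rightarrow> 'v \<Rightarrow> real) \<Rightarrow> bool" where
  "independent_copies M X n N Y \<longleftrightarrow>
     (\<forall>i<n. random_field N (Y i) \<and> same_fdd N (Y i) M X) \<and>
     prob_space.indep_vars N (\<lambda>_. PiM UNIV (\<lambda>_. borel)) (\<lambda>i \<omega> t. Y i t \<omega>) {..<n}"

(* Quantification over all sample spaces is impossible in HOL. The sample type nat => 'w
   carries the n-fold product of M, and hence independent copies of X for every n; the law of
   the rescaled maximum does not depend on the space carrying the copies. *)
definition max_stable :: "'w measure \<Rightarrow> ('t \<Rightarrow> 'w \<Rightarrow> real) \<Rightarrow> bool" where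
  "max_stable M X \<longleftrightarrow>
     (\<forall>n\<ge>1. \<forall>(N :: (nat \<Rightarrow> 'w) measure) Y. prob_space N \<longrightarrow> independent_copies M X n N Y \<longrightarrow>
        same_fdd N (\<lambda>t \<omega>. (MAX i\<in>{..<n}. Y i t \<omega>) / real n) M X)"

(* The case x = 0 is separate because 1 / 0 = 0 in HOL. *)
definition standard_frechet_marginals :: "'w measure \<Rightarrow> ('t \<Rightarrow> 'w \<Rightarrow> real) \<Rightarrow> bool" where
  "standard_frechet_marginals M X \<longleftrightarrow>
     (\<forall>t. \<forall>x\<ge>0. \<P>(\<omega> in M. X t \<omega> \<le> x) = (if x = 0 then 0 else exp (- 1 / x)))"

(* For max-stable fields with standard Frechet marginals the value below does not depend
   on x > 0, so the description is proper. *)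
definition extremal_coefficient :: "'w measure \<Rightarrow> ('t \<Rightarrow> 'w \<Rightarrow> real) \<Rightarrow> 't set \<Rightarrow> real" where
  "extremal_coefficient M X F =
     (if F = {} then 0
      else (THE c. \<forall>x>0. - x * ln (\<P>(\<omega> in M. (MAX t\<in>F. X t \<omega>) \<le> x)) = c))"

definition extremal_correlation :: "'w measure \<Rightarrow> ('t \<Rightarrow> 'w \<Rightarrow> real) \<Rightarrow> 't \<Rightarrow> 't \<Rightarrow> real" where
  "extremal_correlation M X s t = Lim at_top (\<lambda>x. \<P>(\<omega> in M. X s \<omega> \<ge> x \<bar> X t \<omega> \<ge> x))"

(* Only the values of f on finite sets matter. *)
definition continuous_on_finite_sets :: "('t::topological_space set \<Rightarrow> real) \<Rightarrow> bool" where
  "continuous_on_finite_sets f \<longleftrightarrow>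
     (\<forall>m::nat. continuous_map (product_topology (\<lambda>_. euclidean) {..<m}) euclideanreal
            (\<lambda>t. f (t ` {..<m})))"

end

(*
  Max-stability forces P(X_t <= x for all t in F) = exp (- theta F / x), whence
  chi(s,t) = 2 - theta {s,t}. If all X_(s_i) are at most x but some X_(t_i) exceeds x, then
  X_(s_i) <= x < X_(t_i) for some i; multiplying the union bound by x and letting x tend to
  infinity gives
    |theta {t_1,...,t_m} - theta {s_1,...,s_m}| <= sum_i (theta {s_i,t_i} - 1),
  so continuity of theta on pairs implies continuity on all finite sets.
*)
theory Submission
  imports Defs "HOL-Real_Asymp.Real_Asymp"
begin

section \<open>Independent copies on a product space\<close>

lemma (in prob_space) indep_vars_PiM_coordinates:
  assumes "I \<noteq> {}"
  shows "prob_space.indep_vars (PiM I (\<lambda>_. M)) (\<lambda>_. M) (\<lambda>i \<omega>. \<omega> i) I"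
proof -
  interpret P: prob_space "PiM I (\<lambda>_. M)"
    by (intro prob_space_PiM prob_space_axioms)
  \<comment> \<open>Restriction to \<open>I\<close> is the identity on the product space, so the
    joint law of the coordinates is the product measure itself; its factors are the marginal laws,
    which is independence.\<close>
  have "distr (PiM I (\<lambda>_. M)) (PiM I (\<lambda>_. M)) (\<lambda>x. \<lambda>i\<in>I. x i)
      = distr (PiM I (\<lambda>_. M)) (PiM I (\<lambda>_. M)) (\<lambda>x. x)"
    by (intro distr_cong) (auto simp: space_PiM PiE_restrict)
  also have "\<dots> = PiM I (\<lambda>i. distr (PiM I (\<lambda>_. M)) M (\<lambda>\<omega>. \<omega> i))"
    using distr_PiM_component[of I "\<lambda>_. M"] prob_space_axioms
    by (subst distr_id) (intro PiM_cong, auto)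
  finally show ?thesis
    using assms by (subst P.indep_vars_iff_distr_eq_PiM') auto
qed

text \<open>\<open>max_stable\<close> only speaks about copies that are supplied to it. The
  coordinates of the n-fold product supply them, on a sample space of exactly the type over which
  \<open>max_stable\<close> quantifies.\<close>

lemma (in prob_space) independent_copies_PiM:
  assumes X: "\<And>t. X t \<in> borel_measurable M" and "n \<ge> 1"
  shows "independent_copies M X n (PiM {..<n} (\<lambda>_. M)) (\<lambda>i t \<omega>. X t (\<omega> i))"
proof -
  let ?N = "PiM {..<n} (\<lambda>_. M)"
  interpret N: prob_space ?N
    by (intro prob_space_PiM prob_space_axioms)
  have meas: "(\<lambda>\<omega>. X t (\<omega> i)) \<in> borel_measurable ?N" if "i < n" for i t
    using that by (intro measurable_compose[OF _ X] measurable_component_singleton) auto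
  have fdd: "same_fdd ?N (\<lambda>t \<omega>. X t (\<omega> i)) M X" if "i < n" for i
    unfolding same_fdd_def
  proof (intro allI impI)
    fix F :: "'b set"
    have F: "(\<lambda>\<omega>. \<lambda>t\<in>F. X t \<omega>) \<in> measurable M (PiM F (\<lambda>_. borel))"
      by (intro measurable_restrict X)
    have "distr M (PiM F (\<lambda>_. borel)) (\<lambda>\<omega>. \<lambda>t\<in>F. X t \<omega>)
        = distr (distr ?N M (\<lambda>\<omega>. \<omega> i)) (PiM F (\<lambda>_. borel)) (\<lambda>\<omega>. \<lambda>t\<in>F. X t \<omega>)"
      using that distr_PiM_component[of "{..<n}" "\<lambda>_. M" i] prob_space_axioms by simp
    also have "\<dots> = distr ?N (PiM F (\<lambda>_. borel)) (\<lambda>\<omega>. \<lambda>t\<in>F. X t (\<omega> i))"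
      using that by (subst distr_distr[OF F]) (auto simp: comp_def)
    finally show "distr ?N (PiM F (\<lambda>_. borel)) (\<lambda>\<omega>. \<lambda>t\<in>F. X t (\<omega> i)) =
       distr M (PiM F (\<lambda>_. borel)) (\<lambda>\<omega>. \<lambda>t\<in>F. X t \<omega>)" ..
  qed
  \<comment> \<open>Viewing the whole field as one measurable map lets the copies inherit
    independence from the coordinates by composition.\<close>
  have field: "(\<lambda>\<omega> t. X t \<omega>) \<in> measurable M (PiM UNIV (\<lambda>_. borel))"
    using measurable_restrict[of UNIV X M "\<lambda>_. borel", OF X] by (simp add: restrict_def)
  have "N.indep_vars (\<lambda>_. PiM UNIV (\<lambda>_. borel)) (\<lambda>i \<omega> t. X t (\<omega> i)) {..<n}"
    using assms(2)
    by (intro N.indep_vars_compose2[OF indep_vars_PiM_coordinates field]) (auto simp: lessThan_empty_iff)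
  then show ?thesis
    using meas fdd N.prob_space_axioms by (auto simp: independent_copies_def random_field_def)
qed

section \<open>Max-stability as a functional equation\<close>

lemma same_fdd_prob_le:
  assumes "same_fdd N Y M X" "finite F"
    and [measurable]: "\<And>t. t \<in> F \<Longrightarrow> Y t \<in> borel_measurable N"
    and [measurable]: "\<And>t. t \<in> F \<Longrightarrow> X t \<in> borel_measurable M"
  shows "\<P>(\<omega> in N. \<forall>t\<in>F. Y t \<omega> \<le> x) = \<P>(\<omega> in M. \<forall>t\<in>F. X t \<omega> \<le> x)"
proof -
  let ?A = "PiE F (\<lambda>_. {..x::real})"
  have *: "measure (distr L (PiM F (\<lambda>_. borel)) (\<lambda>\<omega>. \<lambda>t\<in>F. Z t \<omega>)) ?A = \<P>(\<omega> in L. \<forall>t\<in>F. Z t \<omega> \<le> x)"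
    if "\<And>t. t \<in> F \<Longrightarrow> Z t \<in> borel_measurable L" for L :: "'z measure" and Z
    using assms(2) that
    by (subst measure_distr) (auto intro!: measurable_restrict sets_PiM_I_finite arg_cong[where f="measure L"])
  show ?thesis
    using assms *[of Y N] *[of X M] by (simp add: same_fdd_def)
qed

text \<open>The rescaled maximum is at most x exactly when every copy is at most n x. On the product
  space this event is a cube with n equal sides, so its probability is an n-th power.\<close>

lemma (in prob_space) max_stable_prob_le:
  assumes X: "\<And>t. X t \<in> borel_measurable M" and "max_stable M X" "finite F" "n \<ge> 1"
  shows "\<P>(\<omega> in M. \<forall>t\<in>F. X t \<omega> \<le> real n * x) ^ n = \<P>(\<omega> in M. \<forall>t\<in>F. X t \<omega> \<le> x)"
proof -
  let ?N = "PiM {..<n} (\<lambda>_. M)"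
  let ?Z = "\<lambda>t \<omega>. (MAX i\<in>{..<n}. X t (\<omega> i)) / real n"
  let ?A = "{\<omega>\<in>space M. \<forall>t\<in>F. X t \<omega> \<le> real n * x}"
  have "same_fdd ?N ?Z M X"
    using assms(2,4) independent_copies_PiM[where X=X, OF X assms(4)]
      prob_space_PiM[of "{..<n}" "\<lambda>_. M", OF prob_space_axioms]
    unfolding max_stable_def by blast
  moreover have "?Z t \<in> borel_measurable ?N" for t
    by (intro borel_measurable_divide borel_measurable_Max
        measurable_compose[OF _ X] measurable_component_singleton) auto
  ultimately have "\<P>(\<omega> in M. \<forall>t\<in>F. X t \<omega> \<le> x) = \<P>(\<omega> in ?N. \<forall>t\<in>F. ?Z t \<omega> \<le> x)"
    using same_fdd_prob_le[of ?N ?Z M X F x] X assms(3) by auto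
  also have "{\<omega>\<in>space ?N. \<forall>t\<in>F. ?Z t \<omega> \<le> x} = PiE {..<n} (\<lambda>_. ?A)"
  proof -
    have "?Z t \<omega> \<le> x \<longleftrightarrow> (\<forall>i<n. X t (\<omega> i) \<le> real n * x)" for t \<omega>
    proof -
      have "?Z t \<omega> \<le> x \<longleftrightarrow> (MAX i\<in>{..<n}. X t (\<omega> i)) \<le> real n * x"
        using \<open>n \<ge> 1\<close> by (simp add: field_simps)
      also have "\<dots> \<longleftrightarrow> (\<forall>i<n. X t (\<omega> i) \<le> real n * x)"
        using \<open>n \<ge> 1\<close> by (subst Max_le_iff) (auto simp: lessThan_empty_iff)
      finally show ?thesis .
    qed
    then show ?thesis
      by (auto simp: space_PiM PiE_iff extensional_def)
  qed
  also have "measure ?N \<dots> = prob ?A ^ n"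
  proof -
    interpret P: finite_product_prob_space "\<lambda>_. M" "{..<n}" by unfold_locales auto
    show ?thesis
      using X assms(3) by (subst P.prob_times) auto
  qed
  finally show ?thesis ..
qed

text \<open>Integer scaling determines g on the positive rationals, and monotonicity fills the gaps,
  as for Cauchy's functional equation. It will be applied to minus the logarithm of a joint
  distribution function.\<close>

lemma antimono_inverse_scaling:
  fixes g :: "real \<Rightarrow> real"
  assumes nonneg: "\<And>x. x > 0 \<Longrightarrow> g x \<ge> 0"
    and antimono: "\<And>x y. 0 < x \<Longrightarrow> x \<le> y \<Longrightarrow> g y \<le> g x"
    and scale: "\<And>x n. x > 0 \<Longrightarrow> n \<ge> 1 \<Longrightarrow> real n * g (real n * x) = g x"
    and "x > 0"
  shows "x * g x = g 1"
proof -
  have rat: "q * g q = g 1" if q: "q \<in> \<rat>" "q > 0" for q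
  proof -
    obtain m n :: nat where mn: "n \<noteq> 0" "q = real m / real n"
      using q by (auto elim!: Rats_abs_nat_div_natE)
    then have "m \<ge> 1"
      using q by (cases m) auto
    \<comment> \<open>Scaling q by n and scaling 1 by m lead to the same value
      \<open>g (real m)\<close>.\<close>
    then have "real n * g (real m) = g q" "real m * g (real m) = g 1" "q * real n = real m"
      using mn q \<open>m \<ge> 1\<close> scale[of q n] scale[of 1 m] by simp_all
    then show ?thesis
      by (metis mult.assoc)
  qed
  have "g 1 \<ge> 0"
    by (rule nonneg) simp
  show ?thesis
  proof (rule antisym; rule ccontr)
    assume "\<not> x * g x \<le> g 1"
    then have "g 1 < x * g x" by simp
    moreover from this have "g x > 0"
      using \<open>g 1 \<ge> 0\<close> \<open>x > 0\<close> zero_less_mult_pos[of x "g x"] by linarith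
    \<comment> \<open>A rational q just below x still has q * g x > g 1, whereas monotonicity gives
      q * g x \<le> q * g q = g 1.\<close>
    ultimately have "g 1 / g x < x" by (simp add: field_simps)
    then obtain q where q: "q \<in> \<rat>" "g 1 / g x < q" "q < x"
      using Rats_dense_in_real by blast
    then have "q > 0"
      using \<open>g x > 0\<close> \<open>g 1 \<ge> 0\<close> by (meson divide_nonneg_pos order.strict_trans1)
    then have "q * g x \<le> g 1"
      using rat[OF q(1)] antimono[of q x] q by (metis less_eq_real_def mult_left_mono)
    then show False
      using q \<open>g x > 0\<close> by (simp add: field_simps)
  next
    assume "\<not> g 1 \<le> x * g x"
    then have less: "x * g x < g 1" by simp
    \<comment> \<open>Symmetrically, q lies just above x. If g x = 0, the bound g 1 / g x is
      meaningless and any rational beyond x will do.\<close>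
    obtain q where q: "q \<in> \<rat>" "x < q" "q * g x < g 1"
    proof (cases "g x = 0")
      case True
      then show ?thesis
        using less that Rats_dense_in_real[of x "x + 1"] by auto
    next
      case False
      then have "g x > 0"
        using nonneg[OF \<open>x > 0\<close>] by simp
      then show ?thesis
        using less that Rats_dense_in_real[of x "g 1 / g x"] by (auto simp: field_simps)
    qed
    moreover have "q * g q \<le> q * g x"
      using q \<open>x > 0\<close> antimono[of x q] by (intro mult_left_mono) auto
    ultimately show False
      using rat[of q] \<open>x > 0\<close> by simp
  qed
qed

lemma limit_pos_real_at_top:
  assumes "\<And>x::real. x > 0 \<Longrightarrow> f x = g x" "(g \<longlongrightarrow> l) at_top"
  shows "(f \<longlongrightarrow> l) at_top"
  using assms(2) eventually_mono[OF eventually_gt_at_top[of 0]]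
  by (rule Lim_transform_eventually) (simp add: assms(1))

section \<open>Exponential form of the joint distribution functions\<close>

locale max_stable_frechet = prob_space M for M :: "'w measure" +
  fixes X :: "'t \<Rightarrow> 'w \<Rightarrow> real"
  assumes measurable_X [measurable]: "\<And>t. X t \<in> borel_measurable M"
    and frechet: "standard_frechet_marginals M X"
    and max_stable: "max_stable M X"
begin

text \<open>The quantifier in place of \<open>MAX\<close> gives the empty set probability 1, in
  accordance with \<theta> = 0 there; the maximum of the empty set is unspecified.\<close>

abbreviation cdf_max :: "'t set \<Rightarrow> real \<Rightarrow> real" where
  "cdf_max F x \<equiv> prob {\<omega>\<in>space M. \<forall>t\<in>F. X t \<omega> \<le> x}"

abbreviation \<theta> :: "'t set \<Rightarrow> real" where
  "\<theta> \<equiv> extremal_coefficient M X"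

lemma prob_le: "x > 0 \<Longrightarrow> prob {\<omega>\<in>space M. X t \<omega> \<le> x} = exp (- 1 / x)"
  using frechet by (simp add: standard_frechet_marginals_def)

lemma sets_le: "finite F \<Longrightarrow> {\<omega>\<in>space M. \<forall>t\<in>F. X t \<omega> \<le> x} \<in> events"
  by measurable

lemma cdf_max_mono:
  assumes "finite F" "x \<le> y" shows "cdf_max F x \<le> cdf_max F y"
  using assms by (intro finite_measure_mono sets_le) force+

text \<open>The union bound leaves 1 minus a finite sum of marginal tails, each of which vanishes at
  infinity.\<close>

lemma cdf_max_tendsto_1:
  assumes "finite F" shows "((\<lambda>x. cdf_max F x) \<longlongrightarrow> 1) at_top"
proof (rule tendsto_sandwich)
  have "1 - (\<Sum>t\<in>F. 1 - exp (- 1 / x)) \<le> cdf_max F x" if "x > 0" for x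
  proof -
    have "1 - cdf_max F x = prob {\<omega>\<in>space M. \<not> (\<forall>t\<in>F. X t \<omega> \<le> x)}"
      by (subst prob_neg) (use assms in \<open>auto simp: sets_le\<close>)
    also have "{\<omega>\<in>space M. \<not> (\<forall>t\<in>F. X t \<omega> \<le> x)} = (\<Union>t\<in>F. {\<omega>\<in>space M. \<not> X t \<omega> \<le> x})"
      by auto
    also have "prob \<dots> \<le> (\<Sum>t\<in>F. prob {\<omega>\<in>space M. \<not> X t \<omega> \<le> x})"
      using assms by (intro measure_UNION_le) auto
    also have "\<dots> = (\<Sum>t\<in>F. 1 - exp (- 1 / x))"
      using that by (intro sum.cong refl, subst prob_neg) (auto simp: prob_le)
    finally show ?thesis by simp
  qed
  then show "\<forall>\<^sub>F x in at_top. 1 - (\<Sum>t\<in>F. 1 - exp (- 1 / x)) \<le> cdf_max F x"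
    by (intro eventually_mono[OF eventually_gt_at_top[of 0]])
  show "\<forall>\<^sub>F x in at_top. cdf_max F x \<le> 1"
    by simp
  have "((\<lambda>x::real. 1 - exp (- 1 / x)) \<longlongrightarrow> 0) at_top"
    by real_asymp
  from tendsto_diff[OF tendsto_const[of 1] tendsto_sum[of F, OF this]]
  show "((\<lambda>x::real. 1 - (\<Sum>t\<in>F. 1 - exp (- 1 / x))) \<longlongrightarrow> 1) at_top"
    by simp
qed simp

text \<open>This makes logarithms meaningful. Far out the value exceeds 1/2, and max-stability
  expresses the value at x as a power of a value far out.\<close>

lemma cdf_max_pos:
  assumes "finite F" "x > 0" shows "cdf_max F x > 0"
proof -
  have "\<forall>\<^sub>F y in at_top. cdf_max F y > 1/2"
    using cdf_max_tendsto_1[OF assms(1)] by (rule order_tendstoD) simp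
  then obtain y where y: "\<And>z. z \<ge> y \<Longrightarrow> cdf_max F z > 1/2"
    by (auto simp: eventually_at_top_linorder)
  obtain n where n: "real n * x > y"
    using reals_Archimedean3[OF assms(2)] by blast
  \<comment> \<open>The successor ensures an exponent of at least 1, since n itself may be
    0.\<close>
  have "real (Suc n) * x \<ge> y"
    using n assms(2) by (simp add: algebra_simps)
  from y[OF this] have "cdf_max F (real (Suc n) * x) > 0"
    by linarith
  then have "cdf_max F (real (Suc n) * x) ^ Suc n > 0"
    by (rule zero_less_power)
  then show ?thesis
    by (subst (asm) max_stable_prob_le[OF measurable_X max_stable assms(1)]) simp_all
qed

text \<open>Minus the logarithm is nonnegative, antimonotone and satisfies the scaling equation,
  hence equals c / x. This also shows that the description defining \<theta> is proper; its
  uniqueness comes from evaluating at 1.\<close>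

lemma cdf_max_eq:
  assumes "finite F" "x > 0"
  shows "cdf_max F x = exp (- \<theta> F / x)"
proof (cases "F = {}")
  case True
  then show ?thesis
    by (simp add: extremal_coefficient_def prob_space)
next
  case False
  let ?g = "\<lambda>x. - ln (cdf_max F x)"
  have const: "x * ?g x = ?g 1" if "x > 0" for x
  proof (rule antimono_inverse_scaling[OF _ _ _ that])
    show "?g x \<ge> 0" if "x > 0" for x
      using cdf_max_pos[OF assms(1) that] by simp
    show "?g y \<le> ?g x" if "0 < x" "x \<le> y" for x y
      using cdf_max_pos[OF assms(1)] that cdf_max_mono[OF assms(1)] by simp
    show "real n * ?g (real n * x) = ?g x" if "x > 0" "n \<ge> 1" for x n
    proof -
      have "cdf_max F x = cdf_max F (real n * x) ^ n"
        using max_stable_prob_le[OF measurable_X max_stable assms(1) that(2)] by simp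
      then show ?thesis
        using that cdf_max_pos[OF assms(1), of "real n * x"] by (simp add: ln_realpow)
    qed
  qed
  have "{\<omega>\<in>space M. (MAX t\<in>F. X t \<omega>) \<le> y} = {\<omega>\<in>space M. \<forall>t\<in>F. X t \<omega> \<le> y}" for y
    using assms(1) False by auto
  then have "\<theta> F = (THE c. \<forall>y>0. y * ?g y = c)"
    using False by (simp add: extremal_coefficient_def)
  also have "\<dots> = ?g 1"
    using const by (intro the_equality) (auto intro: zero_less_one)
  also have "\<dots> = x * ?g x"
    using const assms(2) by simp
  finally show ?thesis
    using assms(2) cdf_max_pos[OF assms] by simp
qed

section \<open>Extremal correlation in terms of \<theta>\<close>

lemma extremal_coefficient_singleton: "\<theta> {t} = 1"
  using cdf_max_eq[of "{t}" 1] prob_le[of 1 t] by simp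

text \<open>The correlation involves events X \<ge> x, whose complements are strict. Continuity from
  below along levels increasing to x, with continuity of the exponential form, gives the same value
  as for \<le>.\<close>

lemma prob_less:
  assumes "finite F" "x > 0"
  shows "prob {\<omega>\<in>space M. \<forall>t\<in>F. X t \<omega> < x} = exp (- \<theta> F / x)"
proof -
  \<comment> \<open>The summand 2 keeps the factor at least 1/2, so every level is positive and
    strictly below x.\<close>
  let ?y = "\<lambda>n::nat. x * (1 - 1 / (real n + 2))"
  have pos: "?y n > 0" for n
    using assms(2) by (intro mult_pos_pos) (auto simp: field_simps)
  have mono: "mono ?y"
    using assms(2) by (intro monoI mult_left_mono) (auto intro!: divide_left_mono)
  have lim: "?y \<longlonglongrightarrow> x"
    by real_asymp
  have "(\<Union>n. {\<omega>\<in>space M. \<forall>t\<in>F. X t \<omega> \<le> ?y n}) = {\<omega>\<in>space M. \<forall>t\<in>F. X t \<omega> < x}"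
  proof (intro set_eqI iffI)
    fix \<omega> assume "\<omega> \<in> (\<Union>n. {\<omega>\<in>space M. \<forall>t\<in>F. X t \<omega> \<le> ?y n})"
    then obtain n where n: "\<omega> \<in> space M" "\<forall>t\<in>F. X t \<omega> \<le> ?y n" by auto
    have "?y n < x"
      using assms(2) by (simp add: field_simps)
    then show "\<omega> \<in> {\<omega>\<in>space M. \<forall>t\<in>F. X t \<omega> < x}"
      using n by force
  next
    fix \<omega> assume \<omega>: "\<omega> \<in> {\<omega>\<in>space M. \<forall>t\<in>F. X t \<omega> < x}"
    then have "\<forall>t\<in>F. \<forall>\<^sub>F n in sequentially. X t \<omega> < ?y n"
      using order_tendstoD(1)[OF lim] by auto
    \<comment> \<open>Finiteness of \<open>F\<close> yields a single n that serves all its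
      points.\<close>
    then have "\<forall>\<^sub>F n in sequentially. \<forall>t\<in>F. X t \<omega> < ?y n"
      using assms(1) by (simp add: eventually_ball_finite)
    then show "\<omega> \<in> (\<Union>n. {\<omega>\<in>space M. \<forall>t\<in>F. X t \<omega> \<le> ?y n})"
      using \<omega> eventually_happens'[OF sequentially_bot] by (fastforce intro: less_imp_le)
  qed
  moreover have "(\<lambda>n. cdf_max F (?y n)) \<longlonglongrightarrow> prob (\<Union>n. {\<omega>\<in>space M. \<forall>t\<in>F. X t \<omega> \<le> ?y n})"
    using assms(1) monoD[OF mono]
    by (intro finite_Lim_measure_incseq) (auto simp: incseq_def sets_le intro: order_trans)
  moreover have "(\<lambda>n. cdf_max F (?y n)) = (\<lambda>n. exp (- \<theta> F / ?y n))"
    using pos assms(1) by (intro ext cdf_max_eq) auto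
  moreover have "(\<lambda>n. exp (- \<theta> F / ?y n)) \<longlonglongrightarrow> exp (- \<theta> F / x)"
    using assms(2) by (intro tendsto_intros lim) auto
  ultimately show ?thesis
    by (simp only: LIMSEQ_unique)
qed

text \<open>Inclusion-exclusion for the complementary events writes the conditional probability
  through exponentials, for every x > 0.\<close>

lemma extremal_correlation_eq: "extremal_correlation M X s t = 2 - \<theta> {s, t}"
proof -
  have "cond_prob M (\<lambda>\<omega>. X s \<omega> \<ge> x) (\<lambda>\<omega>. X t \<omega> \<ge> x)
      = (1 - exp (- 1 / x) - exp (- 1 / x) + exp (- \<theta> {s, t} / x)) / (1 - exp (- 1 / x))"
    if "x > 0" for x
  proof -
    let ?S = "{\<omega>\<in>space M. X s \<omega> < x}" and ?T = "{\<omega>\<in>space M. X t \<omega> < x}"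
    have single: "prob {\<omega>\<in>space M. X r \<omega> < x} = exp (- 1 / x)" for r
      using prob_less[of "{r}" x] that by (simp add: extremal_coefficient_singleton)
    have "prob {\<omega>\<in>space M. X t \<omega> \<ge> x} = 1 - prob ?T"
      by (subst prob_neg[symmetric]) (auto simp: not_less)
    moreover have "prob {\<omega>\<in>space M. X s \<omega> \<ge> x \<and> X t \<omega> \<ge> x} = 1 - prob (?S \<union> ?T)"
      by (subst prob_compl[symmetric]) (auto intro!: arg_cong[where f=prob])
    moreover have "prob (?S \<union> ?T) = prob ?S + prob ?T - prob (?S \<inter> ?T)"
      by (rule measure_Un3) (auto simp: fmeasurable_eq_sets)
    moreover have "?S \<inter> ?T = {\<omega>\<in>space M. \<forall>r\<in>{s, t}. X r \<omega> < x}"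
      by auto
    ultimately show ?thesis
      using prob_less[of "{s, t}" x] that single by (simp add: cond_prob_def)
  qed
  \<comment> \<open>Multiplied by x, the numerator tends to 2 - c and the denominator to 1.\<close>
  moreover have "((\<lambda>x::real. (1 - exp (- 1 / x) - exp (- 1 / x) + exp (- c / x)) / (1 - exp (- 1 / x)))
      \<longlongrightarrow> 2 - c) at_top" for c
    by real_asymp
  ultimately show ?thesis
    unfolding extremal_correlation_def
    by (intro tendsto_Lim[OF _ limit_pos_real_at_top]) simp_all
qed

text \<open>Indexed families rather than sets pair each s i with its t i, even when points coincide
  and the images differ in size. Exchanging s and t later gives the bound on the absolute
  value.\<close>

lemma extremal_coefficient_diff_le:
  assumes "finite I"
  shows "\<theta> (t ` I) - \<theta> (s ` I) \<le> (\<Sum>i\<in>I. \<theta> {s i, t i} - 1)"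
proof (rule tendsto_le)
  \<comment> \<open>The factor x extracts the first-order term, recovering coefficients from
    probabilities.\<close>
  have lim: "((\<lambda>x::real. x * (exp (- a / x) - exp (- b / x))) \<longlongrightarrow> b - a) at_top" for a b
    by real_asymp
  show "((\<lambda>x::real. x * (exp (- \<theta> (s ` I) / x) - exp (- \<theta> (t ` I) / x)))
      \<longlongrightarrow> \<theta> (t ` I) - \<theta> (s ` I)) at_top"
    by (rule lim)
  show "((\<lambda>x::real. \<Sum>i\<in>I. x * (exp (- 1 / x) - exp (- \<theta> {s i, t i} / x)))
      \<longlongrightarrow> (\<Sum>i\<in>I. \<theta> {s i, t i} - 1)) at_top"
    by (intro tendsto_sum lim)
  have "x * (exp (- \<theta> (s ` I) / x) - exp (- \<theta> (t ` I) / x))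
      \<le> (\<Sum>i\<in>I. x * (exp (- 1 / x) - exp (- \<theta> {s i, t i} / x)))" if "x > 0" for x
  proof -
    let ?A = "\<lambda>F. {\<omega>\<in>space M. \<forall>r\<in>F. X r \<omega> \<le> x}"
    have "exp (- \<theta> (s ` I) / x) - exp (- \<theta> (t ` I) / x) = prob (?A (s ` I)) - prob (?A (t ` I))"
      using cdf_max_eq[OF _ that, of "s ` I"] cdf_max_eq[OF _ that, of "t ` I"] assms by simp
    also have "\<dots> \<le> prob (?A (s ` I) - ?A (t ` I))"
    proof -
      have "prob (?A (s ` I)) \<le> prob ((?A (s ` I) - ?A (t ` I)) \<union> ?A (t ` I))"
        using assms by (intro finite_measure_mono) (auto simp: sets_le)
      also have "\<dots> \<le> prob (?A (s ` I) - ?A (t ` I)) + prob (?A (t ` I))"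
        using assms by (intro measure_Un_le sets.Diff sets_le) auto
      finally show ?thesis by simp
    qed
    also have "\<dots> \<le> prob (\<Union>i\<in>I. ?A {s i} - ?A {s i, t i})"
      using assms by (intro finite_measure_mono) (auto simp: sets_le)
    also have "\<dots> \<le> (\<Sum>i\<in>I. prob (?A {s i} - ?A {s i, t i}))"
      using assms by (intro measure_UNION_le) (auto simp: sets_le)
    also have "\<dots> = (\<Sum>i\<in>I. exp (- 1 / x) - exp (- \<theta> {s i, t i} / x))"
    proof (intro sum.cong refl)
      fix i
      \<comment> \<open>The event for the pair is contained in the event for s i, so the
        probabilities subtract exactly.\<close>
      have "prob (?A {s i} - ?A {s i, t i}) = prob (?A {s i}) - prob (?A {s i, t i})"
        by (intro finite_measure_Diff sets_le) auto
      then show "prob (?A {s i} - ?A {s i, t i}) = exp (- 1 / x) - exp (- \<theta> {s i, t i} / x)"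
        using cdf_max_eq[of "{s i, t i}" x] that prob_le by simp
    qed
    finally show ?thesis
      using that by (simp add: flip: sum_distrib_left)
  qed
  then show "\<forall>\<^sub>F x in at_top. x * (exp (- \<theta> (s ` I) / x) - exp (- \<theta> (t ` I) / x))
      \<le> (\<Sum>i\<in>I. x * (exp (- 1 / x) - exp (- \<theta> {s i, t i} / x)))"
    by (intro eventually_mono[OF eventually_gt_at_top[of 0]])
qed simp

end

section \<open>Equivalence of the two continuity properties\<close>

theorem corollary16:
  fixes M :: "'w measure" and X :: "'t::metric_space \<Rightarrow> 'w \<Rightarrow> real"
  assumes "random_field M X"
    and "standard_frechet_marginals M X"
    and "max_stable M X"
  shows "continuous_on_finite_sets (extremal_coefficient M X) \<longleftrightarrow>
         continuous_on UNIV (\<lambda>(s, t). extremal_correlation M X s t)"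
proof -
  interpret prob_space M
    using assms(1) by (simp add: random_field_def)
  interpret max_stable_frechet M X
    using assms by unfold_locales (auto simp: random_field_def)
  let ?prod = "\<lambda>m::nat. product_topology (\<lambda>_. euclidean :: 't topology) {..<m}"
  show ?thesis
  proof
    assume "continuous_on_finite_sets \<theta>"
    then have \<theta>: "continuous_map (?prod 2) euclideanreal (\<lambda>t. \<theta> (t ` {..<2}))"
      by (auto simp: continuous_on_finite_sets_def)
    \<comment> \<open>Pairs become tuples of length 2; the restriction makes them extensional, as
      points of the product topology must be.\<close>
    let ?f = "\<lambda>p :: 't \<times> 't. \<lambda>i\<in>{..<2::nat}. if i = 0 then fst p else snd p"
    have "continuous_map euclidean (?prod 2) ?f"
      by (intro continuous_map_coordinatewise_then_product)
        (auto simp: continuous_on_fst continuous_on_snd continuous_on_id)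
    from continuous_map_compose[OF this \<theta>]
    have "continuous_on UNIV (\<lambda>p. \<theta> (?f p ` {..<2}))"
      by (simp add: comp_def)
    moreover have "?f p ` {..<2} = {fst p, snd p}" for p
      by (auto simp: image_iff lessThan_Suc numeral_2_eq_2)
    ultimately have "continuous_on UNIV (\<lambda>p. \<theta> {fst p, snd p})"
      by simp
    then show "continuous_on UNIV (\<lambda>(s, t). extremal_correlation M X s t)"
      by (auto simp: extremal_correlation_eq case_prod_beta intro!: continuous_intros)
  next
    assume "continuous_on UNIV (\<lambda>(s, t). extremal_correlation M X s t)"
    then have "continuous_on UNIV (\<lambda>p. 2 - (2 - \<theta> {fst p, snd p}))"
      unfolding extremal_correlation_eq case_prod_beta
      by (rule continuous_on_diff[OF continuous_on_const])
    then have cont: "continuous_on UNIV (\<lambda>p. \<theta> {fst p, snd p})"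
      by simp
    show "continuous_on_finite_sets \<theta>"
      unfolding continuous_on_finite_sets_def continuous_map_atin limitin_canonical_iff
    proof (intro allI ballI)
      fix m s assume s: "s \<in> topspace (?prod m)"
      \<comment> \<open>The bound from the union estimate as a function of t, with s fixed. It
        vanishes at t = s because \<theta> is 1 on singletons.\<close>
      let ?d = "\<lambda>t. \<Sum>i<m. \<theta> {s i, t i} - 1"
      have pair: "continuous_on UNIV (\<lambda>r. \<theta> {a, r})" for a
        using continuous_on_compose2[OF cont, of UNIV "\<lambda>r. (a, r)"]
        by (simp add: continuous_on_Pair continuous_on_id)
      have "continuous_map (?prod m) euclideanreal ?d"
      proof (intro continuous_map_sum continuous_map_diff finite_lessThan)
        fix i assume i: "i \<in> {..<m}"
        show "continuous_map (?prod m) euclideanreal (\<lambda>t. \<theta> {s i, t i})"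
          using continuous_map_compose[OF continuous_map_product_projection[OF i], of "\<lambda>_. euclidean"
            euclideanreal "\<lambda>r. \<theta> {s i, r}"] pair by (simp add: comp_def)
      qed auto
      then have "(?d \<longlongrightarrow> ?d s) (atin (?prod m) s)"
        using s unfolding continuous_map_atin limitin_canonical_iff by blast
      then have d: "(?d \<longlongrightarrow> 0) (atin (?prod m) s)"
        by (simp add: extremal_coefficient_singleton)
      \<comment> \<open>Both directions of the estimate have the same right-hand side, since {s i, t
        i} is unordered.\<close>
      have "\<bar>\<theta> (t ` {..<m}) - \<theta> (s ` {..<m})\<bar> \<le> ?d t" for t
        using extremal_coefficient_diff_le[of "{..<m}" t s] extremal_coefficient_diff_le[of "{..<m}" s t]
        by (simp add: insert_commute abs_le_iff)
      then show "((\<lambda>t. \<theta> (t ` {..<m})) \<longlongrightarrow> \<theta> (s ` {..<m})) (atin (?prod m) s)"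
        by (intro LIM_zero_cancel[OF Lim_null_comparison[OF _ d]]) auto
    qed
  qed
qed

end
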